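(* Let $d \ge 1$ be an integer, let $\beta$ be a real number, and let $X_1, X_2, \ldots$ be independent random vectors in $\mathbb{R}^d$, each with mean zero and the same covariance matrix $\Sigma$, such that $\|X_i\| \le \beta$ almost surely for each $i$. Suppose further that the $X_i$ take values in the lattice $\beta \mathbb{Z}^d$. For $n \ge 1$ let $S_n = \frac{1}{\sqrt{n}} \sum_{i=1}^n X_i$, and let $Z$ be a mean-zero Gaussian random vector in $\mathbb{R}^d$ with covariance $\Sigma$. Then $$ \liminf_{n \to \infty} \sqrt{n}\, \mathcal{W}_2(S_n, Z) \ge \frac{\sqrt{d}\, \beta}{4}. $$
   Context: $\|\cdot\|$ is the Euclidean norm on $\mathbb{R}^d$. For probability measures $\mu, \nu$ on $\mathbb{R}^d$, the quadratic transportation (Wasserstein) distance is $$\mathcal{W}_2(\mu,\nu) = \left( \inf_{\gamma \in \Gamma(\mu,\nu)} \int \|x-y\|^2 \, d\gamma(x,y) \right)^{1/2},$$ where $\Gamma(\mu,\nu)$ is the set of probability measures on $\mathbb{R}^d \times \mathbb{R}^d$ with marginals $\mu$ and $\nu$. For random vectors $X, Y$ with laws $\mu, \nu$, one writes $\mathcal{W}_2(X,Y) = \mathcal{W}_2(\mu,\nu)$.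
   Formalization: The covariance matrix Σ is additionally assumed invertible when β ≠ 0; without this the claim fails, e.g. for d = 1, β = 1 and X_i = 0, where the distance is 0 but the bound is 1/4. *)

theory Defs
  imports "HOL-Probability.Probability"
begin

definition couplings ::
  "('a::topological_space) measure \<Rightarrow> ('b::topological_space) measure \<Rightarrow> ('a \<times> 'b) measure set" where
  "couplings \<mu> \<nu> =
     {\<gamma>. prob_space \<gamma> \<and> sets \<gamma> = sets (borel \<Otimes>\<^sub>M borel) \<and>
          distr \<gamma> borel fst = \<mu> \<and> distr \<gamma> borel snd = \<nu>}"

definition transport_cost2 ::
  "('a::euclidean_space) measure \<Rightarrow> 'a measure \<Rightarrow> ennreal" where
  "transport_cost2 \<mu> \<nu> =
     (INF \<gamma>\<in>couplings \<mu> \<nu>. \<integral>\<^sup>+ z. ennreal ((norm (fst z - snd z))\<^sup>2) \<partial>\<gamma>)"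

text \<open>The value is \<infinity> when no coupling has finite cost (no second-moment
  assumption is built in), hence the extended-real codomain.\<close>

definition wasserstein2 ::
  "('a::euclidean_space) measure \<Rightarrow> 'a measure \<Rightarrow> ereal" where
  "wasserstein2 \<mu> \<nu> =
     (if transport_cost2 \<mu> \<nu> = \<infinity> then \<infinity>
      else ereal (sqrt (enn2real (transport_cost2 \<mu> \<nu>))))"

definition covariance_matrix :: "'a measure \<Rightarrow> ('a \<Rightarrow> real^'d) \<Rightarrow> real^'d^'d" where
  "covariance_matrix M X =
     (\<chi> i j. \<integral>\<omega>. (X \<omega> $ i - (\<integral>\<omega>'. X \<omega>' \<partial>M) $ i) * (X \<omega> $ j - (\<integral>\<omega>'. X \<omega>' \<partial>M) $ j) \<partial>M)"

text \<open>One-dimensional normal law with mean \<open>m\<close> and standard deviation \<open>\<sigma>\<close>; for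
  \<open>\<sigma> = 0\<close> it is the point mass at \<open>m\<close>, where \<open>normal_density\<close> is not a density.\<close>

definition normal_law :: "real \<Rightarrow> real \<Rightarrow> real measure" where
  "normal_law m \<sigma> =
     (if \<sigma> = 0 then return borel m else density lborel (\<lambda>x. ennreal (normal_density m \<sigma> x)))"

text \<open>A random vector is Gaussian if all its one-dimensional projections are normal,
  possibly degenerate; its mean and covariance are not fixed here.\<close>

definition gaussian_vector :: "'a measure \<Rightarrow> ('a \<Rightarrow> 'v::euclidean_space) \<Rightarrow> bool" where
  "gaussian_vector M Z \<longleftrightarrow>
     Z \<in> borel_measurable M \<and>
     (\<forall>u. \<exists>m. \<exists>\<sigma>\<ge>0. distr M borel (\<lambda>\<omega>. u \<bullet> Z \<omega>) = normal_law m \<sigma>)"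

definition scaled_int_lattice :: "real \<Rightarrow> (real^'d) set" where
  "scaled_int_lattice \<beta> = (\<lambda>v. \<beta> *\<^sub>R v) ` {v. \<forall>i. v $ i \<in> \<int>}"

text \<open>The summands are indexed from 1; \<open>X 0\<close> plays no role.\<close>

definition normalized_sum :: "(nat \<Rightarrow> 'a \<Rightarrow> 'v::real_vector) \<Rightarrow> nat \<Rightarrow> 'a \<Rightarrow> 'v" where
  "normalized_sum X n \<omega> = (1 / sqrt (real n)) *\<^sub>R (\<Sum>i=1..n. X i \<omega>)"

end

theory Submission
  imports Defs "HOL-Real_Asymp.Real_Asymp"
begin

text \<open>
  Put \<open>h = \<beta> / sqrt n\<close>. The vector \<open>S\<^sub>n\<close> lives on the lattice \<open>h\<int>\<^sup>d\<close>, so every coupling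
  costs at least the mean squared distance of \<open>Z\<close> to that lattice, coordinate by coordinate.
  The squared distance to \<open>\<int>\<close> is replaced by a trigonometric polynomial below it: from
  \<open>t\<^sup>2 \<ge> sin\<^sup>2 t + sin\<^sup>4 t / 3\<close> (the difference has second derivative \<open>16/3 sin\<^sup>4 t\<close>) at
  \<open>t = \<pi> (y - x) / h\<close>, whose right-hand side is independent of \<open>x \<in> h\<int>\<close>. Since the
  characteristic function of a nondegenerate normal law vanishes at infinity, only the constant
  Fourier coefficient \<open>5/8\<close> survives in the limit, and \<open>5 / (8 \<pi>\<^sup>2) \<ge> 1/16\<close> because
  \<open>\<pi>\<^sup>2 \<le> 10\<close>.
\<close>

section \<open>A trigonometric minorant of the squared distance to a lattice\<close>

text \<open>Fourier form of \<open>(sin (\<theta>/2))^2 + (sin (\<theta>/2))^4 / 3\<close>. For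
  \<open>\<theta> = 2 * t\<close> with small \<open>t\<close>, these are the first two terms of
  \<open>t^2 = (arcsin (sin t))^2\<close> as a series in \<open>sin t\<close>. The first term alone
  has mean 1/2, which is too little, since \<open>1 / (2 * pi^2) < 1/16\<close>.\<close>

definition square_minorant :: "real \<Rightarrow> real" where
  "square_minorant \<theta> = 5 / 8 - 2 / 3 * cos \<theta> + cos (2 * \<theta>) / 24"

lemma square_minorant_double:
  "square_minorant (2 * t) = (sin t)\<^sup>2 + (sin t)^4 / 3"
proof -
  have c: "cos (2 * t) = 1 - 2 * (sin t)\<^sup>2"
    by (simp add: cos_double_sin)
  have "cos (2 * (2 * t)) = 2 * (1 - 2 * (sin t)\<^sup>2)\<^sup>2 - 1"
    by (subst cos_double_cos, subst c) simp
  then show ?thesis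
    unfolding square_minorant_def c
    by (simp add: power2_eq_square power4_eq_xxxx algebra_simps)
qed

lemma square_minorant_nonneg: "0 \<le> square_minorant \<theta>"
  using square_minorant_double[of "\<theta> / 2"] by simp

lemma square_minorant_le_square: "square_minorant (2 * t) \<le> t\<^sup>2"
proof -
  define f where "f t = t\<^sup>2 - (sin t)\<^sup>2 - (sin t)^4 / 3" for t :: real
  define f' where "f' t = 2 * t - 2 * sin t * cos t - 4 / 3 * (sin t)^3 * cos t" for t :: real
  define f'' where "f'' t = 16 / 3 * (sin t)^4" for t :: real
  \<comment> \<open>\<open>f\<close> is convex and \<open>f 0 = f' 0 = 0\<close>, so lying above its
    tangent at 0 means being nonnegative.\<close>
  have "f' 0 * (t - 0) \<le> f t - f 0"
  proof (rule f''_imp_f'[of UNIV f f' f''])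
    show "DERIV f x :> f' x" for x
      unfolding f_def f'_def
      by (auto intro!: derivative_eq_intros simp: power2_eq_square power3_eq_cube)
    \<comment> \<open>With \<open>s = sin x\<close> and \<open>c = cos x\<close>, the left side is
      the derivative of \<open>f'\<close> as the product rule produces it; the Pythagorean identity
      collapses it to \<open>f'' x\<close>.\<close>
    have eq: "2 - 2 * (c * c - s * s) - 4 / 3 * (3 * s^2 * c * c - s^4) = 16 / 3 * s^4"
      if "c\<^sup>2 = 1 - s\<^sup>2" for s c :: real
    proof -
      have "c * c = 1 - s * s" using that by (simp add: power2_eq_square)
      then have "3 * s^2 * c * c = 3 * s^2 * (1 - s * s)" by (simp add: mult.assoc)
      with \<open>c * c = 1 - s * s\<close> show ?thesis
        by (simp add: power2_eq_square power4_eq_xxxx algebra_simps)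
    qed
    show "DERIV f' x :> f'' x" for x
      unfolding f'_def f''_def eq[OF cos_squared_eq, symmetric]
      by (rule derivative_eq_intros refl | simp)+
        (simp add: power2_eq_square power3_eq_cube power4_eq_xxxx field_simps)
  qed (auto simp: f''_def)
  then show ?thesis
    by (simp add: f_def f'_def square_minorant_double)
qed

lemma square_minorant_lattice:
  assumes "h > 0" and "x / h \<in> \<int>"
  shows "h\<^sup>2 / pi\<^sup>2 * square_minorant (2 * pi / h * y) \<le> (x - y)\<^sup>2"
proof -
  obtain k where k: "x / h = of_int k"
    using assms(2) by (auto elim: Ints_cases)
  \<comment> \<open>This is \<open>pi * (y - x) / h\<close>. In this form the lattice point only
    shifts \<open>2 * t\<close> by whole periods, so the minorant loses its dependence on
    \<open>x\<close>.\<close>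
  define t where "t = pi * y / h - pi * of_int k"
  have "cos (2 * t) = cos (2 * pi / h * y)"
    using cos_int_2pin[of k] sin_int_2pin[of k] by (simp add: t_def right_diff_distrib cos_diff mult_ac)
  \<comment> \<open>The double angle formula carries the periodicity over to the second
    harmonic.\<close>
  moreover have "cos (2 * (2 * t)) = cos (2 * (2 * pi / h * y))"
    unfolding cos_double_cos[of "2 * t"] cos_double_cos[of "2 * pi / h * y"] using calculation by simp
  ultimately have "square_minorant (2 * pi / h * y) \<le> t\<^sup>2"
    using square_minorant_le_square[of t] by (simp add: square_minorant_def)
  then have "h\<^sup>2 / pi\<^sup>2 * square_minorant (2 * pi / h * y) \<le> h\<^sup>2 / pi\<^sup>2 * t\<^sup>2"
    by (intro mult_left_mono) auto
  also have "\<dots> = (x - y)\<^sup>2"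
  proof -
    have "t = pi / h * (y - x)"
      using assms(1) k by (simp add: t_def field_simps)
    then show ?thesis
      using assms(1) by (simp add: power_mult_distrib power_divide power2_commute)
  qed
  finally show ?thesis .
qed

section \<open>A numerical bound on pi\<close>

lemma pi_squared_le_10: "pi\<^sup>2 \<le> 10"
proof (rule ccontr)
  assume "\<not> pi\<^sup>2 \<le> 10"
  \<comment> \<open>\<open>x = sqrt 10 / 6\<close> is to be compared with \<open>pi / 6\<close>,
    where the sine is exactly 1/2. If pi exceeded \<open>sqrt 10\<close>, then \<open>sin x\<close>
    would lie below 1/2, which the Taylor bound refutes.\<close>
  define x :: real where "x = sqrt (10 / 36)"
  have x2: "x\<^sup>2 = 10 / 36" by (simp add: x_def)
  have x0: "x > 0" by (simp add: x_def)
  have "x\<^sup>2 < (pi / 6)\<^sup>2"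
    using \<open>\<not> pi\<^sup>2 \<le> 10\<close> by (simp add: x2 power_divide)
  then have "x < pi / 6"
    by (rule power_less_imp_less_base) simp
  then have "sin x < sin (pi / 6)"
    using x0 by (intro sin_monotone_2pi) auto
  then have s: "sin x < 1 / 2" by (simp add: sin_30)
  have "\<bar>sin x - (x - x^3 / 6)\<bar> \<le> x^5 / 120"
    using Maclaurin_sin_bound[of x 5] x0
    by (simp add: lessThan_nat_numeral sin_coeff_def fact_numeral)
  moreover have "x^3 = x * (10 / 36)"
    by (simp add: power3_eq_cube x2[symmetric] power2_eq_square)
  moreover have "x^5 = x * (10 / 36) * (10 / 36)"
    by (simp add: eval_nat_numeral x2[symmetric])
  \<comment> \<open>The Taylor lower bound is \<open>x * (1 - 10/216 - 100/155520)\<close>, with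
    factor about 0.953.\<close>
  ultimately have "x * (95 / 100) \<le> sin x"
    using x0 by linarith
  moreover have "1 / 2 \<le> x * (95 / 100)"
  proof -
    have "527 / 1000 \<le> x"
      by (rule power2_le_imp_le) (use x0 in \<open>auto simp: x2 power_divide\<close>)
    then show ?thesis by simp
  qed
  ultimately show False using s by simp
qed

section \<open>Fourier decay of normal laws\<close>

text \<open>The law is the image of the standard normal law under
  \<open>x \<mapsto> m + \<sigma> * x\<close>: the shift contributes a phase and the scaling a
  change of frequency.\<close>

lemma char_normal_density:
  assumes "\<sigma> > 0"
  shows "char (density lborel (\<lambda>x. ennreal (normal_density m \<sigma> x))) t
    = iexp (t * m) * of_real (exp (- (\<sigma> * t)\<^sup>2 / 2))"
proof -
  interpret S: prob_space std_normal_distribution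
    by (rule prob_space_normal_density) simp
  have "distributed std_normal_distribution lborel (\<lambda>x. x) std_normal_density"
    by (auto simp: distributed_def distr_id2)
  from S.normal_density_affine[OF this, of \<sigma> m] assms
  have "distributed std_normal_distribution lborel (\<lambda>x. m + \<sigma> * x) (normal_density m \<sigma>)"
    by simp
  then have "density lborel (\<lambda>x. ennreal (normal_density m \<sigma> x))
      = distr std_normal_distribution lborel (\<lambda>x. m + \<sigma> * x)"
    by (simp add: distributed_def)
  then have "char (density lborel (\<lambda>x. ennreal (normal_density m \<sigma> x))) t
      = (CLINT x|std_normal_distribution. iexp (t * (m + \<sigma> * x)))"
    by (simp add: char_def integral_distr)
  also have "\<dots> = (CLINT x|std_normal_distribution. iexp (t * m) * iexp ((\<sigma> * t) * x))"
    by (simp add: exp_add[symmetric] algebra_simps)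
  also have "\<dots> = iexp (t * m) * char std_normal_distribution (\<sigma> * t)"
    by (simp add: char_def)
  finally show ?thesis
    by (simp add: char_std_normal_distribution)
qed

text \<open>The integral is the real part of the characteristic function. Passing to the modulus
  removes the phase coming from \<open>m\<close> and leaves a Gaussian in \<open>t\<close>.\<close>

lemma integral_cos_normal_tendsto_0:
  assumes "\<sigma> > 0"
  shows "((\<lambda>t. \<integral>x. cos (t * x) \<partial>density lborel (\<lambda>x. ennreal (normal_density m \<sigma> x))) \<longlongrightarrow> 0) at_top"
proof (rule tendsto_rabs_zero_cancel, rule tendsto_sandwich[of "\<lambda>_. 0" _ _ "\<lambda>t. exp (- (\<sigma> * t)\<^sup>2 / 2)"])
  let ?D = "density lborel (\<lambda>x. ennreal (normal_density m \<sigma> x))"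
  interpret D: prob_space ?D
    using assms by (rule prob_space_normal_density)
  have "\<bar>\<integral>x. cos (t * x) \<partial>?D\<bar> \<le> exp (- (\<sigma> * t)\<^sup>2 / 2)" for t
  proof -
    have "integrable ?D (\<lambda>x. iexp (t * x))"
      using D.integrable_iexp[of "\<lambda>x. of_real (t * x)"] by simp
    then have "(\<integral>x. cos (t * x) \<partial>?D) = Re (char ?D t)"
      by (simp add: char_def integral_Re[symmetric] Re_exp)
    also have "\<bar>\<dots>\<bar> \<le> cmod (char ?D t)"
      by (rule abs_Re_le_cmod)
    also have "\<dots> = exp (- (\<sigma> * t)\<^sup>2 / 2)"
      unfolding char_normal_density[OF assms] by (simp add: norm_mult norm_exp_i_times[of "t * m", simplified])
    finally show ?thesis .
  qed
  then show "\<forall>\<^sub>F t in at_top. \<bar>\<integral>x. cos (t * x) \<partial>?D\<bar> \<le> exp (- (\<sigma> * t)\<^sup>2 / 2)"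
    by simp
  show "((\<lambda>t. exp (- (\<sigma> * t)\<^sup>2 / 2)) \<longlongrightarrow> 0) at_top"
    using assms by real_asymp
qed auto

lemma integral_square_minorant_tendsto:
  assumes "\<sigma> > 0"
  shows "((\<lambda>t. \<integral>x. square_minorant (t * x) \<partial>density lborel (\<lambda>x. ennreal (normal_density m \<sigma> x))) \<longlongrightarrow> 5 / 8) at_top"
proof -
  let ?D = "density lborel (\<lambda>x. ennreal (normal_density m \<sigma> x))"
  interpret D: prob_space ?D
    using assms by (rule prob_space_normal_density)
  let ?C = "\<lambda>t. \<integral>x. cos (t * x) \<partial>?D"
  have int: "integrable ?D (\<lambda>x. cos (t * x))" for t
    by (rule D.integrable_const_bound[of _ 1]) auto
  have "(\<integral>x. square_minorant (t * x) \<partial>?D) = 5 / 8 - 2 / 3 * ?C t + ?C (2 * t) / 24" for t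
    using int[of t] int[of "2 * t"] D.prob_space
    by (simp add: square_minorant_def mult.assoc)
  moreover have "((\<lambda>t. ?C (2 * t)) \<longlongrightarrow> 0) at_top"
    by (rule filterlim_compose[OF integral_cos_normal_tendsto_0[OF assms]]) real_asymp
  then have "((\<lambda>t. 5 / 8 - 2 / 3 * ?C t + ?C (2 * t) / 24) \<longlongrightarrow> 5 / 8 - 2 / 3 * 0 + 0 / 24) at_top"
    by (intro tendsto_intros integral_cos_normal_tendsto_0 assms) auto
  ultimately show ?thesis by simp
qed

section \<open>Lower bounds for the transport cost\<close>

text \<open>The easy direction of Kantorovich duality, with zero potential on the first marginal: a
  minorant of the cost that depends on \<open>y\<close> alone has the same integral under every
  coupling.\<close>

lemma transport_cost2_ge:
  fixes \<phi> :: "'a::euclidean_space \<Rightarrow> ennreal"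
  assumes "\<phi> \<in> borel_measurable borel"
    and "AE x in \<mu>. \<forall>y. \<phi> y \<le> ennreal ((norm (x - y))\<^sup>2)"
  shows "(\<integral>\<^sup>+ y. \<phi> y \<partial>\<nu>) \<le> transport_cost2 \<mu> \<nu>"
  unfolding transport_cost2_def
proof (rule INF_greatest)
  fix \<gamma> assume "\<gamma> \<in> couplings \<mu> \<nu>"
  then have sets [measurable_cong]: "sets \<gamma> = sets (borel \<Otimes>\<^sub>M borel)"
    and \<mu>: "\<mu> = distr \<gamma> borel fst" and \<nu>: "\<nu> = distr \<gamma> borel snd"
    by (auto simp: couplings_def)
  have "(\<integral>\<^sup>+ y. \<phi> y \<partial>\<nu>) = (\<integral>\<^sup>+ z. \<phi> (snd z) \<partial>\<gamma>)"
    unfolding \<nu> using assms(1) by (intro nn_integral_distr) measurable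
  also have "\<dots> \<le> (\<integral>\<^sup>+ z. ennreal ((norm (fst z - snd z))\<^sup>2) \<partial>\<gamma>)"
  proof (rule nn_integral_mono_AE)
    \<comment> \<open>The exceptional null set in \<open>x\<close> does not depend on
      \<open>y\<close>, so after pulling it back along \<open>fst\<close> one may take
      \<open>y = snd z\<close>.\<close>
    have "fst \<in> \<gamma> \<rightarrow>\<^sub>M borel" by measurable
    from AE_distrD[OF this assms(2)[unfolded \<mu>]]
    show "AE z in \<gamma>. \<phi> (snd z) \<le> ennreal ((norm (fst z - snd z))\<^sup>2)"
      by auto
  qed
  finally show "(\<integral>\<^sup>+ y. \<phi> y \<partial>\<nu>) \<le> (\<integral>\<^sup>+ z. ennreal ((norm (fst z - snd z))\<^sup>2) \<partial>\<gamma>)" .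
qed

lemma wasserstein2_ge:
  assumes "ennreal c \<le> transport_cost2 \<mu> \<nu>" and "c \<ge> 0"
  shows "ereal (sqrt c) \<le> wasserstein2 \<mu> \<nu>"
  using assms enn2real_mono[OF assms(1)]
  by (auto simp: wasserstein2_def top.not_eq_extremum)

section \<open>Coordinates of Gaussian vectors\<close>

lemma integrable_normal_law:
  assumes "\<sigma> \<ge> 0"
  shows "integrable (normal_law m \<sigma>) (\<lambda>x. x)"
proof (cases "\<sigma> = 0")
  case True
  interpret prob_space "return borel m"
    by (rule prob_space_return) simp
  show ?thesis
    using True
    by (auto simp: normal_law_def AE_return intro!: integrable_const_bound[of _ "\<bar>m\<bar>"])
next
  case False
  with assms have "\<sigma> > 0" by simp
  then show ?thesis
    using integrable_normal_moment_nz_1[of \<sigma> m]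
    by (simp add: normal_law_def integrable_density)
qed

lemma gaussian_vector_component:
  fixes Z :: "'b \<Rightarrow> real^'d"
  assumes "gaussian_vector N Z"
  obtains m \<sigma> where "\<sigma> \<ge> 0" "distr N borel (\<lambda>\<omega>. Z \<omega> $ i) = normal_law m \<sigma>"
proof -
  from assms obtain m \<sigma> where "\<sigma> \<ge> 0"
    and "distr N borel (\<lambda>\<omega>. axis i 1 \<bullet> Z \<omega>) = normal_law m \<sigma>"
    unfolding gaussian_vector_def by blast
  with that show ?thesis
    by (simp add: inner_axis')
qed

lemma borel_measurable_vec_component [measurable (raw)]:
  fixes f :: "'a \<Rightarrow> real^'d"
  assumes "f \<in> borel_measurable M"
  shows "(\<lambda>x. f x $ i) \<in> borel_measurable M"
  using assms by (rule borel_measurable_continuous_on[rotated]) (intro continuous_intros)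

text \<open>Integrability allows coordinates to be taken inside the mean of \<open>Z\<close>. It is
  checked on each coordinate law and reassembled in the standard basis.\<close>

lemma gaussian_vector_integrable:
  fixes Z :: "'b \<Rightarrow> real^'d"
  assumes "gaussian_vector N Z"
  shows "integrable N Z"
proof -
  have [measurable]: "Z \<in> borel_measurable N"
    using assms by (simp add: gaussian_vector_def)
  have "integrable N (\<lambda>\<omega>. Z \<omega> $ i)" for i
  proof -
    obtain m \<sigma> where "\<sigma> \<ge> 0" "distr N borel (\<lambda>\<omega>. Z \<omega> $ i) = normal_law m \<sigma>"
      using gaussian_vector_component[OF assms] .
    then have "integrable (distr N borel (\<lambda>\<omega>. Z \<omega> $ i)) (\<lambda>x. x)"
      by (simp add: integrable_normal_law)
    then show ?thesis
      by (subst (asm) integrable_distr_eq) auto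
  qed
  then have "integrable N (\<lambda>\<omega>. \<Sum>i\<in>UNIV. Z \<omega> $ i *\<^sub>R axis i 1)"
    by (intro Bochner_Integration.integrable_sum) auto
  also have "(\<lambda>\<omega>. \<Sum>i\<in>UNIV. Z \<omega> $ i *\<^sub>R axis i 1) = Z"
    using basis_expansion[of "Z \<omega>" for \<omega>] by (simp add: scalar_mult_eq_scaleR)
  finally show ?thesis .
qed

text \<open>A coordinate with \<open>\<sigma> = 0\<close> equals its mean almost surely, so its row
  of the covariance matrix vanishes and the determinant is zero. Such coordinates must be excluded:
  one concentrated at 0 would contribute only \<open>square_minorant 0 = 0\<close>.\<close>

lemma gaussian_vector_nondegenerate_component:
  fixes Z :: "'b \<Rightarrow> real^'d"
  assumes "prob_space N" and "gaussian_vector N Z" and "invertible (covariance_matrix N Z)"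
  obtains m \<sigma> where "\<sigma> > 0"
    "distr N borel (\<lambda>\<omega>. Z \<omega> $ i) = density lborel (\<lambda>x. ennreal (normal_density m \<sigma> x))"
proof -
  interpret prob_space N by fact
  have [measurable]: "Z \<in> borel_measurable N"
    using assms(2) by (simp add: gaussian_vector_def)
  obtain m \<sigma> where \<sigma>: "\<sigma> \<ge> 0" and law: "distr N borel (\<lambda>\<omega>. Z \<omega> $ i) = normal_law m \<sigma>"
    using gaussian_vector_component[OF assms(2)] .
  have "\<sigma> \<noteq> 0"
  proof
    assume "\<sigma> = 0"
    then have "AE x in distr N borel (\<lambda>\<omega>. Z \<omega> $ i). x = m"
      unfolding law normal_law_def by (auto simp: AE_return)
    then have AE: "AE \<omega> in N. Z \<omega> $ i = m"
      by (subst (asm) AE_distr_iff) auto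
    have "(\<integral>\<omega>. Z \<omega> \<partial>N) $ i = (\<integral>\<omega>. Z \<omega> $ i \<partial>N)"
      using gaussian_vector_integrable[OF assms(2)]
      by (simp add: integral_bounded_linear[OF bounded_linear_vec_nth])
    also have "\<dots> = (\<integral>\<omega>. m \<partial>N)"
      using AE by (intro integral_cong_AE) auto
    finally have "(\<integral>\<omega>. Z \<omega> \<partial>N) $ i = m"
      by (simp add: prob_space)
    then have "AE \<omega> in N. (Z \<omega> $ i - (\<integral>\<omega>'. Z \<omega>' \<partial>N) $ i) * (Z \<omega> $ j - (\<integral>\<omega>'. Z \<omega>' \<partial>N) $ j) = 0" for j
      using AE by auto
    then have "covariance_matrix N Z $ i $ j = 0" for j
      unfolding covariance_matrix_def by (simp add: integral_eq_zero_AE)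
    then have "row i (covariance_matrix N Z) = 0"
      by (simp add: row_def vec_eq_iff)
    then have "det (covariance_matrix N Z) = 0"
      by (rule det_zero_row)
    with assms(3) show False
      by (simp add: invertible_det_nz)
  qed
  then show ?thesis
    using \<sigma> law that[of \<sigma> m] by (simp add: normal_law_def)
qed

section \<open>Distance from a lattice law to the law of \<open>Z\<close>\<close>

text \<open>The rescaled minorants, summed over coordinates, bound the squared distance from any
  lattice point; the resulting bound involves only the mesh \<open>h\<close> and the law of
  \<open>Z\<close>.\<close>

lemma wasserstein2_lattice_ge:
  fixes S :: "'a \<Rightarrow> real^'d" and Z :: "'b \<Rightarrow> real^'d"
  assumes "prob_space N" and S [measurable]: "S \<in> borel_measurable M"
    and Z [measurable]: "Z \<in> borel_measurable N"
    and h: "h > 0" and lattice: "AE \<omega> in M. \<forall>i. S \<omega> $ i / h \<in> \<int>"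
  shows "ereal (sqrt (h\<^sup>2 / pi\<^sup>2 * (\<Sum>i\<in>UNIV. \<integral>\<omega>. square_minorant (2 * pi / h * Z \<omega> $ i) \<partial>N)))
    \<le> wasserstein2 (distr M borel S) (distr N borel Z)"
proof -
  interpret prob_space N by fact
  define \<phi> :: "real^'d \<Rightarrow> real" where
    "\<phi> y = h\<^sup>2 / pi\<^sup>2 * (\<Sum>i\<in>UNIV. square_minorant (2 * pi / h * y $ i))" for y
  have [measurable]: "square_minorant \<in> borel_measurable borel"
    unfolding square_minorant_def by measurable
  have [measurable]: "\<phi> \<in> borel_measurable borel"
    unfolding \<phi>_def by measurable
  have \<phi>_nonneg: "0 \<le> \<phi> y" for y
    by (simp add: \<phi>_def sum_nonneg square_minorant_nonneg)
  have \<phi>_le: "\<phi> y \<le> (norm (x - y))\<^sup>2" if "\<forall>i. x $ i / h \<in> \<int>" for x y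
  proof -
    have "\<phi> y \<le> (\<Sum>i\<in>UNIV. (x $ i - y $ i)\<^sup>2)"
      unfolding \<phi>_def sum_distrib_left
      by (intro sum_mono square_minorant_lattice h) (use that in auto)
    also have "\<dots> = (norm (x - y))\<^sup>2"
      unfolding power2_norm_eq_inner inner_vec_def by (simp add: power2_eq_square)
    finally show ?thesis .
  qed
  \<comment> \<open>Closedness of the integers makes the lattice condition measurable, so that it
    transfers to the law of \<open>S\<close>.\<close>
  have [measurable]: "(\<int> :: real set) \<in> sets borel"
    by (intro borel_closed closed_Ints)
  have "AE x in distr M borel S. \<forall>i. x $ i / h \<in> \<int>"
    using lattice by (subst AE_distr_iff) auto
  then have "(\<integral>\<^sup>+ y. ennreal (\<phi> y) \<partial>distr N borel Z) \<le> transport_cost2 (distr M borel S) (distr N borel Z)"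
    by (intro transport_cost2_ge) (auto intro!: ennreal_leI \<phi>_le)
  moreover have int: "integrable N (\<lambda>\<omega>. square_minorant (2 * pi / h * Z \<omega> $ i))" for i
    unfolding square_minorant_def
    by (intro Bochner_Integration.integrable_add Bochner_Integration.integrable_diff
        integrable_mult_right integrable_divide_zero integrable_const
        integrable_const_bound[of _ 1]) auto
  then have "integrable N (\<lambda>\<omega>. \<phi> (Z \<omega>))"
    unfolding \<phi>_def by auto
  then have "(\<integral>\<^sup>+ y. ennreal (\<phi> y) \<partial>distr N borel Z) = ennreal (\<integral>\<omega>. \<phi> (Z \<omega>) \<partial>N)"
    by (subst nn_integral_distr) (auto intro!: nn_integral_eq_integral simp: \<phi>_nonneg)
  ultimately have "ereal (sqrt (\<integral>\<omega>. \<phi> (Z \<omega>) \<partial>N)) \<le> wasserstein2 (distr M borel S) (distr N borel Z)"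
    by (intro wasserstein2_ge) (auto simp: \<phi>_nonneg)
  also have "(\<integral>\<omega>. \<phi> (Z \<omega>) \<partial>N) = h\<^sup>2 / pi\<^sup>2 * (\<Sum>i\<in>UNIV. \<integral>\<omega>. square_minorant (2 * pi / h * Z \<omega> $ i) \<partial>N)"
    unfolding \<phi>_def using int by simp
  finally show ?thesis .
qed

text \<open>Dividing by the mesh \<open>\<beta> / sqrt n\<close> cancels the normalization and
  leaves a sum of the integers \<open>X i \<omega> $ j / \<beta>\<close>.\<close>

lemma normalized_sum_lattice:
  fixes X :: "nat \<Rightarrow> 'a \<Rightarrow> real^'d"
  assumes "\<beta> > 0" and "n \<ge> 1"
    and "\<And>i. i \<ge> 1 \<Longrightarrow> AE \<omega> in M. X i \<omega> \<in> scaled_int_lattice \<beta>"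
  shows "AE \<omega> in M. \<forall>j. normalized_sum X n \<omega> $ j / (\<beta> / sqrt (real n)) \<in> \<int>"
proof -
  have "AE \<omega> in M. \<forall>i\<in>{1..n}. X i \<omega> \<in> scaled_int_lattice \<beta>"
    using assms(3) by (intro AE_finite_allI) auto
  then show ?thesis
  proof eventually_elim
    case (elim \<omega>)
    have "X i \<omega> $ j / \<beta> \<in> \<int>" if "i \<in> {1..n}" for i j
      using elim that assms(1) by (force simp: scaled_int_lattice_def)
    then have "(\<Sum>i=1..n. X i \<omega> $ j / \<beta>) \<in> \<int>" for j
      by (intro Ints_sum)
    moreover have "normalized_sum X n \<omega> $ j / (\<beta> / sqrt (real n)) = (\<Sum>i=1..n. X i \<omega> $ j / \<beta>)" for j
      using assms(1,2) by (simp add: normalized_sum_def sum_divide_distrib[symmetric])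
    ultimately show ?case by simp
  qed
qed

section \<open>Passage to the limit as the mesh shrinks\<close>

theorem proposition1p2:
  fixes M :: "'a measure" and N :: "'b measure"
    and X :: "nat \<Rightarrow> 'a \<Rightarrow> real^'d" and Z :: "'b \<Rightarrow> real^'d"
    and \<Sigma> :: "real^'d^'d" and \<beta> :: real
  assumes "prob_space M" and "prob_space N"
    and indep: "prob_space.indep_vars M (\<lambda>_. borel) X {1..}"
    and mean: "\<And>i. i \<ge> 1 \<Longrightarrow> (\<integral>\<omega>. X i \<omega> \<partial>M) = 0"
    and cov: "\<And>i. i \<ge> 1 \<Longrightarrow> covariance_matrix M (X i) = \<Sigma>"
    and bounded: "\<And>i. i \<ge> 1 \<Longrightarrow> AE \<omega> in M. norm (X i \<omega>) \<le> \<beta>"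
    and lattice: "\<And>i. i \<ge> 1 \<Longrightarrow> AE \<omega> in M. X i \<omega> \<in> scaled_int_lattice \<beta>"
    and nondegenerate: "\<beta> \<noteq> 0 \<Longrightarrow> invertible \<Sigma>"
    and gaussian: "gaussian_vector N Z"
    and gaussian_mean: "(\<integral>\<omega>. Z \<omega> \<partial>N) = 0"
    and gaussian_cov: "covariance_matrix N Z = \<Sigma>"
  shows "liminf (\<lambda>n. ereal (sqrt (real n)) *
             wasserstein2 (distr M borel (normalized_sum X n)) (distr N borel Z))
           \<ge> ereal (sqrt (real CARD('d)) * \<beta> / 4)"
proof (cases "\<beta> > 0")
  \<comment> \<open>For \<open>\<beta> \<le> 0\<close> the claimed bound is nonpositive, while the
    distance is nonnegative.\<close>
  case False
  have "0 \<le> wasserstein2 (distr M borel (normalized_sum X n)) (distr N borel Z)" for n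
    by (simp add: wasserstein2_def)
  then have "0 \<le> liminf (\<lambda>n. ereal (sqrt (real n)) *
      wasserstein2 (distr M borel (normalized_sum X n)) (distr N borel Z))"
    by (intro Liminf_bounded) auto
  moreover have "ereal (sqrt (real CARD('d)) * \<beta> / 4) \<le> 0"
    using False by (simp add: mult_le_0_iff)
  ultimately show ?thesis
    by (rule order_trans[rotated])
next
  case True
  interpret M: prob_space M by fact
  have X: "X i \<in> borel_measurable M" if "i \<ge> 1" for i
    using indep that by (simp add: M.indep_vars_def)
  have S: "normalized_sum X n \<in> borel_measurable M" for n
    unfolding normalized_sum_def
    by (intro borel_measurable_scaleR borel_measurable_const borel_measurable_sum X) auto
  have Z [measurable]: "Z \<in> borel_measurable N"
    using gaussian by (simp add: gaussian_vector_def)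
  define E where "E t i = (\<integral>\<omega>. square_minorant (t * Z \<omega> $ i) \<partial>N)" for t i
  \<comment> \<open>The frequency \<open>2 * pi / h\<close> for the mesh
    \<open>h = \<beta> / sqrt n\<close>; it grows like \<open>sqrt n\<close>. The default value 0 at
    \<open>n = 0\<close> does not affect the limit.\<close>
  define t where "t n = 2 * pi / (\<beta> / sqrt (real n))" for n :: nat
  have "((\<lambda>t. E t i) \<longlongrightarrow> 5 / 8) at_top" for i
  proof -
    obtain m \<sigma> where \<sigma>: "\<sigma> > 0" and law: "distr N borel (\<lambda>\<omega>. Z \<omega> $ i)
        = density lborel (\<lambda>x. ennreal (normal_density m \<sigma> x))"
      using gaussian_vector_nondegenerate_component[OF assms(2) gaussian] nondegenerate gaussian_cov True
      by (metis less_irrefl)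
    have "E t i = (\<integral>x. square_minorant (t * x) \<partial>distr N borel (\<lambda>\<omega>. Z \<omega> $ i))" for t
      unfolding E_def square_minorant_def by (subst integral_distr) auto
    then show ?thesis
      unfolding law using integral_square_minorant_tendsto[OF \<sigma>] by simp
  qed
  moreover have "filterlim t at_top sequentially"
    unfolding t_def using True by real_asymp
  ultimately have "(\<lambda>n. E (t n) i) \<longlonglongrightarrow> 5 / 8" for i
    by (rule filterlim_compose)
  then have lim: "(\<lambda>n. ereal (sqrt (\<beta>\<^sup>2 / pi\<^sup>2 * (\<Sum>i\<in>UNIV. E (t n) i))))
      \<longlonglongrightarrow> ereal (sqrt (\<beta>\<^sup>2 / pi\<^sup>2 * (\<Sum>i\<in>(UNIV::'d set). 5 / 8)))"
    by (intro tendsto_intros) auto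
  have "sqrt (real CARD('d)) * \<beta> / 4 = sqrt (real CARD('d) * \<beta>\<^sup>2 / 16)"
    using True by (simp add: real_sqrt_mult real_sqrt_divide)
  also have "\<dots> \<le> sqrt (\<beta>\<^sup>2 / pi\<^sup>2 * (\<Sum>i\<in>(UNIV::'d set). 5 / 8))"
  proof (rule real_sqrt_le_mono)
    have "1 / 16 \<le> 5 / (8 * pi\<^sup>2)"
      using pi_squared_le_10 by (simp add: field_simps)
    then have "real CARD('d) * \<beta>\<^sup>2 * (1 / 16) \<le> real CARD('d) * \<beta>\<^sup>2 * (5 / (8 * pi\<^sup>2))"
      by (intro mult_left_mono) auto
    then show "real CARD('d) * \<beta>\<^sup>2 / 16 \<le> \<beta>\<^sup>2 / pi\<^sup>2 * (\<Sum>i\<in>(UNIV::'d set). 5 / 8)"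
      by (simp add: field_simps)
  qed
  finally have "ereal (sqrt (real CARD('d)) * \<beta> / 4)
      \<le> liminf (\<lambda>n. ereal (sqrt (\<beta>\<^sup>2 / pi\<^sup>2 * (\<Sum>i\<in>UNIV. E (t n) i))))"
    using lim_imp_Liminf[OF _ lim] by simp
  also have "\<dots> \<le> liminf (\<lambda>n. ereal (sqrt (real n)) *
      wasserstein2 (distr M borel (normalized_sum X n)) (distr N borel Z))"
  proof (rule Liminf_mono, rule eventually_sequentiallyI)
    fix n :: nat assume n: "n \<ge> 1"
    let ?h = "\<beta> / sqrt (real n)"
    \<comment> \<open>The outer factor \<open>sqrt n\<close> exactly compensates the mesh, since
      \<open>n * ?h^2 = \<beta>^2\<close>.\<close>
    have "ereal (sqrt (\<beta>\<^sup>2 / pi\<^sup>2 * (\<Sum>i\<in>UNIV. E (t n) i)))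
        = ereal (sqrt (real n)) * ereal (sqrt (?h\<^sup>2 / pi\<^sup>2 * (\<Sum>i\<in>UNIV. E (t n) i)))"
      using n by (simp add: real_sqrt_mult[symmetric] power_divide)
    also have "\<dots> \<le> ereal (sqrt (real n)) *
        wasserstein2 (distr M borel (normalized_sum X n)) (distr N borel Z)"
      unfolding E_def t_def using True n
      by (intro ereal_mult_left_mono wasserstein2_lattice_ge assms(2) S Z
          normalized_sum_lattice lattice) auto
    finally show "ereal (sqrt (\<beta>\<^sup>2 / pi\<^sup>2 * (\<Sum>i\<in>UNIV. E (t n) i)))
        \<le> ereal (sqrt (real n)) *
          wasserstein2 (distr M borel (normalized_sum X n)) (distr N borel Z)" .
  qed
  finally show ?thesis .
qed

end
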